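(* Let $a,\rho\in\mathcal V$ with $a\neq\rho$, let $\mathcal M=\{m_1,\dots,m_{|\mathcal M|}\}\subseteq\mathcal V$ be non-empty, and consider the strictly proper LTI systems $\Sigma_\rho=(-\bar L,e_a,e_\rho^\top,0)$ and $\Sigma_{m_k}=(-\bar L,e_a,e_{m_k}^\top,0)$, $m_k\in\mathcal M$, which share the same attack input $\zeta$ at vertex $a$. Let $r_{(\rho,a)}$ and $r_{(m_k,a)}$ be the relative degrees of $\Sigma_\rho$ and $\Sigma_{m_k}$, respectively. Then the quantity $$\overline J_\rho(a,\mathcal M)=\min_{m_k\in\mathcal M}\ \sup\Big\{\|y_\rho\|_{\mathcal L_2}^2\ :\ \zeta\in\mathcal L_{2e},\ x(0)=0,\ \|y_{m_k}\|_{\mathcal L_2}^2\le\delta_{m_k}\Big\}$$ is bounded (i.e. $\overline J_\rho(a,\mathcal M)<\infty$) if, and only if, there exists at least one $m_k\in\mathcal M$ such that $r_{(m_k,a)}\le r_{(\rho,a)}$.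
   Context: Graph: $\mathcal G=(\mathcal V,\mathcal E,A)$ is an undirected connected graph with vertex set $\mathcal V=\{1,\dots,N\}$ and symmetric adjacency matrix $A=[a_{ij}]$, where $a_{ij}>0$ if $(i,j)\in\mathcal E$, $i\ne j$, and $a_{ij}=0$ otherwise. $L=\Delta-A$ is the Laplacian, with $\Delta$ the diagonal degree matrix, $\Delta_i=\sum_j a_{ij}$. Self-loop gains $\theta_i>0$ are given, $\Theta=\mathrm{diag}(\theta_1,\dots,\theta_N)$, and $\bar L=L+\Theta$. $e_i\in\mathbb R^N$ is the $i$-th standard basis vector. Dynamics: $\dot x(t)=-\bar L x(t)+e_a\zeta(t)$, $x(0)=0$, with scalar attack signal $\zeta$; $y_\rho(t)=e_\rho^\top x(t)$, $y_{m_k}(t)=e_{m_k}^\top x(t)$. A system with state-space model $\dot x=\bar Ax+\bar Bu$, $y=\bar Cx+\bar Du$ is denoted $(\bar A,\bar B,\bar C,\bar D)$. Alarm thresholds $\delta_{m}>0$ are given for all vertices $m$. Norms: for a fixed time horizon $[0,T]$, $T>0$, $\|y\|_{\mathcal L_2}^2$ is shorthand for $\|y\|^2_{\mathcal L_2[0,T]}=\frac1T\int_0^T\|y(t)\|_2^2\,dt$. $\mathcal L_{2e}$ is the space of functions $f:\mathbb R_+\to\mathbb R$ with $\|f\|^2_{\mathcal L_2[0,T']}<\infty$ for all $0<T'<\infty$. Relative degree: a strictly proper system $(\bar A,\bar B,\bar C,0)$ with $\bar A\in\mathbb R^{n\times n}$ has relative degree $r$ ($1\le r\le n$) if $\bar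 C\bar A^k\bar B=0$ for $0\le k<r-1$ and $\bar C\bar A^{r-1}\bar B\ne0$. Invariant zeros: $\bar\lambda\in\mathbb C$ is a finite invariant zero of $(\bar A,\bar B,\bar C,0)$ (single input) if there are $\bar x\ne0$ in $\mathbb C^N$ and $\bar g\in\mathbb C$ with $(\bar\lambda I-\bar A)\bar x-\bar B\bar g=0$ and $\bar C\bar x=0$; it is unstable if its real part is positive. Standing design assumption: the self-loop gains $\theta_i$ are selected so that for every pair of input vertex $a$ and output vertex $m$, the system $(-\bar L,e_a,e_m^\top,0)$ has no finite unstable invariant zero. *)

theory Defs
  imports "HOL-Analysis.Analysis"
begin

text \<open>The vertex set is the whole finite type \<open>'n\<close>, so $N$ is \<open>CARD('n)\<close>.\<close>

definition connected_weighted_graph :: "('n::finite \<times> 'n) set \<Rightarrow> real^'n^'n \<Rightarrow> bool" where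
  "connected_weighted_graph E A \<longleftrightarrow>
     sym E \<and> (\<forall>i j. (i, j) \<in> E\<^sup>*) \<and> transpose A = A \<and>
     (\<forall>i j. if (i, j) \<in> E \<and> i \<noteq> j then A $ i $ j > 0 else A $ i $ j = 0)"

definition diag_matrix :: "'a::zero^'n \<Rightarrow> 'a^'n^'n" where
  "diag_matrix d = (\<chi> i j. if i = j then d $ i else 0)"

definition laplacian :: "real^'n^'n \<Rightarrow> real^'n^'n" where
  "laplacian A = diag_matrix (\<chi> i. \<Sum>j\<in>UNIV. A $ i $ j) - A"

definition looped_laplacian :: "real^'n^'n \<Rightarrow> real^'n \<Rightarrow> real^'n^'n" where
  "looped_laplacian A \<theta> = laplacian A + diag_matrix \<theta>"

text \<open>
  Such a system $(A, b, c^\top, 0)$ is represented by the matrix \<open>A\<close> and the vectors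
  \<open>b\<close> and \<open>c\<close>.
\<close>

(* The componentwise product makes the type-class power unsuitable for matrices. *)
definition matrix_power :: "'a::semiring_1^'n^'n \<Rightarrow> nat \<Rightarrow> 'a^'n^'n" where
  "matrix_power A k = (((**) A) ^^ k) (mat 1)"

definition has_relative_degree :: "real^'n^'n \<Rightarrow> real^'n \<Rightarrow> real^'n \<Rightarrow> nat \<Rightarrow> bool" where
  "has_relative_degree A b c r \<longleftrightarrow>
     1 \<le> r \<and> r \<le> CARD('n) \<and>
     (\<forall>k < r - 1. c \<bullet> (matrix_power A k *v b) = 0) \<and>
     c \<bullet> (matrix_power A (r - 1) *v b) \<noteq> 0"

lemma has_relative_degree_unique:
  assumes "has_relative_degree A b c r" "has_relative_degree A b c s"
  shows "r = s"
proof -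
  have "\<not> r - 1 < s - 1" "\<not> s - 1 < r - 1"
    using assms unfolding has_relative_degree_def by blast+
  moreover have "1 \<le> r" "1 \<le> s"
    using assms unfolding has_relative_degree_def by blast+
  ultimately show ?thesis by linarith
qed

(* Meaningful only if a relative degree exists; for looped Laplacians of connected graphs
   and standard basis vectors it always does. *)
definition relative_degree :: "real^'n^'n \<Rightarrow> real^'n \<Rightarrow> real^'n \<Rightarrow> nat" where
  "relative_degree A b c = (THE r. has_relative_degree A b c r)"

definition invariant_zero :: "real^'n^'n \<Rightarrow> real^'n \<Rightarrow> real^'n \<Rightarrow> complex \<Rightarrow> bool" where
  "invariant_zero A b c z \<longleftrightarrow>
     (\<exists>(x :: complex^'n) (g :: complex). x \<noteq> 0 \<and>
        (mat z - map_matrix complex_of_real A) *v x - g *s (\<chi> i. complex_of_real (b $ i)) = 0 \<and>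
        (\<Sum>i\<in>UNIV. complex_of_real (c $ i) * x $ i) = 0)"

text \<open>
  Inputs are merely locally square integrable, so $\dot x = A x + b u$ on $[0,\infty)$ is
  understood in the sense of Caratheodory, i.e. as the equivalent integral equation. Since
  this makes \<open>x\<close> continuous, the gauge integral below coincides with the Lebesgue integral
  for such inputs.
\<close>

definition is_trajectory ::
    "real^'n^'n \<Rightarrow> real^'n \<Rightarrow> (real \<Rightarrow> real) \<Rightarrow> (real \<Rightarrow> real^'n) \<Rightarrow> bool" where
  "is_trajectory A b u x \<longleftrightarrow>
     (\<forall>t\<ge>0. ((\<lambda>s. A *v x s + u s *\<^sub>R b) has_integral (x t - x 0)) {0..t})"

(* The squared norm is extended real valued, so that it may be infinite. *)
definition L2_norm_sq :: "real \<Rightarrow> (real \<Rightarrow> real) \<Rightarrow> ennreal" where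
  "L2_norm_sq T y = (\<integral>\<^sup>+ t. ennreal ((norm (y t))\<^sup>2) \<partial>lebesgue_on {0..T}) / ennreal T"

definition L2e :: "(real \<Rightarrow> real) set" where
  "L2e = {f. f \<in> borel_measurable (lebesgue_on {0..}) \<and> (\<forall>T>0. L2_norm_sq T f < \<infinity>)}"

definition worst_case_impact ::
    "real \<Rightarrow> real^'n^'n \<Rightarrow> ('n \<Rightarrow> real) \<Rightarrow> 'n \<Rightarrow> 'n \<Rightarrow> 'n set \<Rightarrow> ennreal" where
  "worst_case_impact T L \<delta> \<rho> a M =
     Min ((\<lambda>m. Sup {L2_norm_sq T (\<lambda>t. axis \<rho> 1 \<bullet> x t) | \<zeta> x.
                      \<zeta> \<in> L2e \<and> is_trajectory (- L) (axis a 1) \<zeta> x \<and> x 0 = 0 \<and>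
                      L2_norm_sq T (\<lambda>t. axis m 1 \<bullet> x t) \<le> ennreal (\<delta> m)}) ` M)"

end

(*
  On a finite horizon only the high-frequency behaviour of y_rho relative to y_m matters.
  If r_m <= r_rho, a linear change of the state turns the system into one that is driven by
  y_m instead of the input (an inverse system), and Gronwall's inequality bounds y_rho by y_m.
  If r_m > r_rho, the monomial inputs t^N / N! give y_rho ~ g t^q / q! while y_m is of the order
  of t^(q+1) / (q+1)!, hence smaller by a factor O(1/q) uniformly on [0, T]; rescaling makes
  y_rho arbitrarily large under the constraint on y_m.
*)
theory Submission
  imports Defs
begin

text \<open>An inverse system usually involves derivatives of its output, and a bound on the L2 norm
  of y_m controls none of them; nor can a merely square integrable input be treated as
  differentiable. The state change is therefore built to absorb these derivatives: in the new state
  the input cancels, and y_m enters undifferentiated, as a source and as a direct term of y_rho. For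
  the converse the horizon is fixed, so shrinking it is no option. A large exponent N acts as a high
  frequency instead, and the response is an explicit power series whose remainder constant does not
  depend on N. Relative degrees exist because of the graph: they are distances plus one, since walks
  of minimal length contribute to the powers of the system matrix without cancellation.\<close>

section \<open>Matrix powers and the norm of continuous signals\<close>

lemma matrix_power_mult_vector:
  fixes A :: "real^'n^'n"
  shows "matrix_power A k *v x = (((*v) A) ^^ k) x"
proof (induction k)
  case (Suc k)
  then show ?case
    by (simp add: matrix_power_def flip: matrix_vector_mul_assoc)
qed (simp add: matrix_power_def)

text \<open>Passes from the extended nonnegative integral to the real gauge integral, in which all
  estimates are made.\<close>

lemma L2_norm_sq_continuous:
  assumes "T > 0" "continuous_on {0..T} y"
  shows "L2_norm_sq T y = ennreal (integral {0..T} (\<lambda>t. (y t)\<^sup>2) / T)"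
proof -
  have i: "integrable (lebesgue_on {0..T}) (\<lambda>t. (y t)\<^sup>2)"
    by (intro continuous_imp_integrable_real continuous_intros assms)
  have "(\<integral>\<^sup>+ t. ennreal ((norm (y t))\<^sup>2) \<partial>lebesgue_on {0..T})
      = ennreal (integral {0..T} (\<lambda>t. (y t)\<^sup>2))"
    using nn_integral_eq_integral[OF i] lebesgue_integral_eq_integral[OF i] by simp
  moreover have "integral {0..T} (\<lambda>t. (y t)\<^sup>2) \<ge> 0"
    by (intro integral_nonneg integrable_continuous_real continuous_intros assms) auto
  ultimately show ?thesis
    using \<open>T > 0\<close> by (simp add: L2_norm_sq_def divide_ennreal)
qed

section \<open>Inverse system and Gronwall estimate\<close>

lemma funpow_linear: "linear f \<Longrightarrow> linear (f ^^ k)" for f :: "'a::real_vector \<Rightarrow> 'a"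
  by (induction k) (simp_all add: linear_compose linear_id)

text \<open>
  \<open>S\<close> splits off the directions \<open>(P ^^ j) b\<close> in which the input and the derivatives of
  the output \<open>c \<bullet> x\<close> act; the remaining part of the state is driven by that output alone.
\<close>

lemma output_driven_reduction:
  fixes f :: "'a::euclidean_space \<Rightarrow> 'a"
  assumes f: "linear f"
    and c: "\<And>k. k < p \<Longrightarrow> c \<bullet> (f ^^ k) b = 0" "c \<bullet> (f ^^ p) b \<noteq> 0"
    and d: "\<And>k. k < p \<Longrightarrow> d \<bullet> (f ^^ k) b = 0"
  obtains S P q \<kappa> where "linear S" "linear P" "S b = 0"
    "\<And>x. S (f x) = P (S x) + (c \<bullet> x) *\<^sub>R q"
    "\<And>x. d \<bullet> x = d \<bullet> S x + \<kappa> * (c \<bullet> x)"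
proof -
  define g where "g = c \<bullet> (f ^^ p) b"
  have g: "g \<noteq> 0" using c by (simp add: g_def)
  \<comment> \<open>The system under the feedback that holds derivative \<open>p + 1\<close> of the
    output at zero: \<open>c \<bullet> (f ^^ p) (P x) = 0\<close>, because \<open>g\<close> is the
    gain of the input in that derivative.\<close>
  define P where "P = (\<lambda>x. f x - ((c \<bullet> (f ^^ Suc p) x) / g) *\<^sub>R b)"
  have lf: "linear (f ^^ k)" for k by (rule funpow_linear[OF f])
  have P: "linear P"
    unfolding P_def
    by (rule linearI)
      (simp_all add: linear_add[OF f] linear_scale[OF f] linear_add[OF lf] linear_scale[OF lf]
        inner_add_right algebra_simps add_divide_distrib del: funpow.simps)
  \<comment> \<open>Without input, \<open>c \<bullet> (f ^^ (p - j)) x\<close> is derivative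
    \<open>p - j\<close> of the output, so the orders from 0 to \<open>p\<close> are all
    absorbed.\<close>
  define S where "S = (\<lambda>x. x - (\<Sum>j\<le>p. ((c \<bullet> (f ^^ (p - j)) x) / g) *\<^sub>R (P ^^ j) b))"
  have S: "linear S"
    unfolding S_def
    by (rule linearI)
      (simp_all add: linear_add[OF lf] linear_scale[OF lf] inner_add_right scaleR_add_left
        add_divide_distrib sum.distrib scaleR_right.sum scaleR_diff_right)
  have Sb: "S b = 0"
  proof -
    have "(\<Sum>j\<le>p. ((c \<bullet> (f ^^ (p - j)) b) / g) *\<^sub>R (P ^^ j) b)
        = (\<Sum>j\<in>{0}. ((c \<bullet> (f ^^ (p - j)) b) / g) *\<^sub>R (P ^^ j) b)"
      by (rule sum.mono_neutral_right) (auto simp: c(1))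
    then show ?thesis using g by (simp add: S_def g_def)
  qed
  have SA: "S (f x) = P (S x) + (c \<bullet> x) *\<^sub>R ((1 / g) *\<^sub>R (P ^^ Suc p) b)" for x
  proof -
    have "S (f x) = f x - (\<Sum>j\<le>p. ((c \<bullet> (f ^^ (Suc p - j)) x) / g) *\<^sub>R (P ^^ j) b)"
      unfolding S_def by (auto simp: Suc_diff_le funpow_swap1 intro!: sum.cong)
    \<comment> \<open>Adding the summand \<open>j = Suc p\<close>, whose coefficient is the output
      \<open>c \<bullet> x\<close> itself, makes the sum shiftable. The summand \<open>j = 0\<close>
      then turns \<open>f x\<close> into \<open>P x\<close>, the others form \<open>P (S x)\<close>,
      and the added term, moved back, is the source.\<close>
    also have "\<dots> + ((c \<bullet> (f ^^ (Suc p - Suc p)) x) / g) *\<^sub>R - (P ^^ Suc p) b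
        = f x - (\<Sum>j\<le>Suc p. ((c \<bullet> (f ^^ (Suc p - j)) x) / g) *\<^sub>R (P ^^ j) b)"
      by (simp del: funpow.simps)
    also have "\<dots> = P x - (\<Sum>j\<le>p. ((c \<bullet> (f ^^ (p - j)) x) / g) *\<^sub>R (P ^^ Suc j) b)"
      by (subst sum.atMost_Suc_shift) (simp add: P_def del: funpow.simps(2))
    also have "\<dots> = P (S x)"
      unfolding S_def by (simp add: linear_diff[OF P] linear_sum[OF P] linear_scale[OF P])
    finally show ?thesis by (simp add: algebra_simps)
  qed
  \<comment> \<open>\<open>P\<close> differs from \<open>f\<close> by a multiple of
    \<open>b\<close>, so each \<open>P\<close> can be traded for an \<open>f\<close> at the cost of
    a term that \<open>d\<close> annihilates.\<close>
  have dP: "d \<bullet> (f ^^ i) ((P ^^ j) b) = 0" if "i + j < p" for i j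
    using that
  proof (induction j arbitrary: i)
    case 0
    then show ?case using d by simp
  next
    case (Suc j)
    have "(f ^^ i) ((P ^^ Suc j) b)
        = (f ^^ Suc i) ((P ^^ j) b) - ((c \<bullet> (f ^^ Suc p) ((P ^^ j) b)) / g) *\<^sub>R (f ^^ i) b"
      by (simp add: P_def linear_diff[OF lf] linear_scale[OF lf] funpow_swap1)
    then show ?case using Suc.IH[of "Suc i"] Suc.prems d[of i]
      by (simp add: inner_diff_right del: funpow.simps)
  qed
  \<comment> \<open>Of the directions split off, \<open>d\<close> sees only \<open>j = p\<close>,
    and its coefficient contains no derivative of the output.\<close>
  have dS: "d \<bullet> x = d \<bullet> S x + ((d \<bullet> (P ^^ p) b) / g) * (c \<bullet> x)" for x
  proof -
    have "(\<Sum>j\<le>p. ((c \<bullet> (f ^^ (p - j)) x) / g) * (d \<bullet> (P ^^ j) b))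
        = (\<Sum>j\<in>{p}. ((c \<bullet> (f ^^ (p - j)) x) / g) * (d \<bullet> (P ^^ j) b))"
      by (rule sum.mono_neutral_right) (use dP[of 0] in auto)
    then show ?thesis
      by (simp add: S_def inner_diff_right inner_sum_right)
  qed
  show ?thesis using that[OF S P Sb SA dS] .
qed

text \<open>The weighted energy \<open>exp (- K * t) * (\<xi> t \<bullet> \<xi> t)\<close> minus the
  source energy spent up to time \<open>t\<close> never increases. \<open>C\<close> is fixed before
  the solution and the source, which makes the later bound uniform over all attacks.\<close>

lemma linear_ode_gronwall:
  fixes P :: "'a::euclidean_space \<Rightarrow> 'a"
  assumes P: "linear P"
  obtains C where "C \<ge> 0"
    "\<And>\<xi> v t. \<lbrakk>\<And>t. t \<in> {0..T} \<Longrightarrow>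
        (\<xi> has_vector_derivative P (\<xi> t) + v t *\<^sub>R q) (at t within {0..T});
      continuous_on {0..T} v; \<xi> 0 = 0; t \<in> {0..T}\<rbrakk>
      \<Longrightarrow> (norm (\<xi> t))\<^sup>2 \<le> C * integral {0..T} (\<lambda>s. (v s)\<^sup>2)"
proof -
  obtain B where B: "\<And>x. norm (P x) \<le> B * norm x" "B > 0"
    using linear_bounded_pos[OF P] by blast
  \<comment> \<open>\<open>2 * B\<close> pays for the linear part; the square of
    \<open>norm q\<close> comes from splitting the mixed term
    \<open>2 * (v s * (\<xi> s \<bullet> q))\<close> into two squares.\<close>
  define K where "K = 2 * B + (norm q)\<^sup>2"
  have K: "K \<ge> 0" using B by (simp add: K_def)
  show ?thesis
  proof (rule that[of "exp (K * T)"])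
    fix \<xi> :: "real \<Rightarrow> 'a" and v t
    assume d: "\<And>t. t \<in> {0..T} \<Longrightarrow>
        (\<xi> has_vector_derivative P (\<xi> t) + v t *\<^sub>R q) (at t within {0..T})"
      and v: "continuous_on {0..T} v" and "\<xi> 0 = 0" and t: "t \<in> {0..T}"
    define J where "J = (\<lambda>t. integral {0..t} (\<lambda>s. (v s)\<^sup>2))"
    define \<psi> where "\<psi> = (\<lambda>t. exp (- K * t) * (\<xi> t \<bullet> \<xi> t) - J t)"
    have v2: "continuous_on {0..T} (\<lambda>s. (v s)\<^sup>2)"
      by (intro continuous_intros v)
    define \<psi>' where "\<psi>' = (\<lambda>s. exp (- K * s) * (2 * (\<xi> s \<bullet> (P (\<xi> s) + v s *\<^sub>R q)))
        + (- K) * exp (- K * s) * (\<xi> s \<bullet> \<xi> s) - (v s)\<^sup>2)"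
    have der: "(\<psi> has_real_derivative \<psi>' s) (at s within {0..T})" if "s \<in> {0..T}" for s
    proof -
      have 1: "(J has_real_derivative (v s)\<^sup>2) (at s within {0..T})"
        unfolding J_def using integral_has_real_derivative[OF v2 that] .
      have 2: "((\<lambda>t. \<xi> t \<bullet> \<xi> t) has_real_derivative 2 * (\<xi> s \<bullet> (P (\<xi> s) + v s *\<^sub>R q)))
          (at s within {0..T})"
        using has_derivative_inner[OF d[OF that, unfolded has_vector_derivative_def]
            d[OF that, unfolded has_vector_derivative_def]]
        unfolding has_field_derivative_def
        by (rule has_derivative_eq_rhs) (auto simp: inner_commute algebra_simps)
      show ?thesis
        unfolding \<psi>_def \<psi>'_def
        by (rule derivative_eq_intros 1 2 refl | simp)+
    qed
    have "\<psi>' s \<le> 0" if "s \<in> {0..T}" for s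
    proof -
      have "\<xi> s \<bullet> P (\<xi> s) \<le> norm (\<xi> s) * norm (P (\<xi> s))"
        by (rule norm_cauchy_schwarz)
      also have "\<dots> \<le> norm (\<xi> s) * (B * norm (\<xi> s))"
        by (intro mult_left_mono B) auto
      finally have 1: "\<xi> s \<bullet> P (\<xi> s) \<le> B * (\<xi> s \<bullet> \<xi> s)"
        by (simp add: power2_norm_eq_inner[symmetric] power2_eq_square mult_ac)
      have "2 * (v s * (\<xi> s \<bullet> q)) \<le> (\<xi> s \<bullet> q)\<^sup>2 + (v s)\<^sup>2"
        using sum_squares_bound[of "v s" "\<xi> s \<bullet> q"] by (simp add: mult_ac)
      also have "(\<xi> s \<bullet> q)\<^sup>2 \<le> (norm q)\<^sup>2 * (\<xi> s \<bullet> \<xi> s)"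
        using Cauchy_Schwarz_ineq[of "\<xi> s" q] by (simp add: power2_norm_eq_inner mult_ac)
      finally have 2: "2 * (v s * (\<xi> s \<bullet> q)) \<le> (norm q)\<^sup>2 * (\<xi> s \<bullet> \<xi> s) + (v s)\<^sup>2"
        by simp
      have "2 * (\<xi> s \<bullet> (P (\<xi> s) + v s *\<^sub>R q)) - K * (\<xi> s \<bullet> \<xi> s) \<le> (v s)\<^sup>2"
        using 1 2 by (simp add: inner_add_right K_def algebra_simps)
      then have "exp (- K * s) * (2 * (\<xi> s \<bullet> (P (\<xi> s) + v s *\<^sub>R q)) - K * (\<xi> s \<bullet> \<xi> s))
          \<le> exp (- K * s) * (v s)\<^sup>2"
        by (intro mult_left_mono) auto
      also have "\<dots> \<le> 1 * (v s)\<^sup>2"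
        using K that by (intro mult_right_mono) auto
      finally show ?thesis by (simp add: \<psi>'_def algebra_simps)
    qed
    have "\<psi> t \<le> \<psi> 0"
    proof (rule DERIV_nonpos_imp_decreasing_open[of 0 t \<psi>])
      show "0 \<le> t" using t by simp
      show "\<exists>y. (\<psi> has_real_derivative y) (at s) \<and> y \<le> 0" if "0 < s" "s < t" for s
        using der[of s] \<open>\<And>s. s \<in> {0..T} \<Longrightarrow> \<psi>' s \<le> 0\<close>[of s] that t
        by (auto simp: at_within_Icc_at)
      have "continuous_on {0..T} \<psi>"
        using der DERIV_continuous continuous_on_eq_continuous_within by blast
      then show "continuous_on {0..t} \<psi>"
        by (rule continuous_on_subset) (use t in auto)
    qed
    also have "\<psi> 0 = 0" by (simp add: \<psi>_def J_def \<open>\<xi> 0 = 0\<close>)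
    finally have "exp (- K * t) * (norm (\<xi> t))\<^sup>2 \<le> J t"
      by (simp add: \<psi>_def power2_norm_eq_inner)
    also have "J t \<le> J T"
      unfolding J_def using t
      by (intro integral_subset_le integrable_continuous_real continuous_on_subset[OF v2]) auto
    finally have "exp (K * t) * (exp (- K * t) * (norm (\<xi> t))\<^sup>2) \<le> exp (K * t) * J T"
      by simp
    also have "\<dots> \<le> exp (K * T) * J T"
      using t K by (intro mult_right_mono) (auto simp: J_def intro!: mult_left_mono integral_nonneg integrable_continuous_real v2)
    finally show "(norm (\<xi> t))\<^sup>2 \<le> exp (K * T) * integral {0..T} (\<lambda>s. (v s)\<^sup>2)"
      by (simp add: J_def mult.assoc[symmetric] flip: exp_add)
  qed simp
qed

section \<open>Continuity of trajectories and power series solutions\<close>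

text \<open>Even for a discontinuous input the state is an indefinite integral.\<close>

lemma trajectory_continuous:
  assumes "is_trajectory A b u x"
  shows "continuous_on {0..T} x"
proof (cases "T \<ge> 0")
  case True
  let ?h = "\<lambda>s. A *v x s + u s *\<^sub>R b"
  have h: "(?h has_integral (x t - x 0)) {0..t}" if "t \<ge> 0" for t
    using assms that by (auto simp: is_trajectory_def)
  have "continuous_on {0..T} (\<lambda>t. x 0 + integral {0..t} ?h)"
    using h[OF True] by (intro continuous_intros indefinite_integral_continuous_1) auto
  moreover have "x 0 + integral {0..t} ?h = x t" if "t \<in> {0..T}" for t
    using integral_unique[OF h[of t]] that by simp
  ultimately show ?thesis
    by (rule continuous_on_eq)
qed simp

lemma norm_funpow_bound:
  fixes f :: "'a::real_normed_vector \<Rightarrow> 'a"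
  assumes "\<And>x. norm (f x) \<le> K * norm x" "K > 0"
  shows "norm ((f ^^ k) b) \<le> K ^ k * norm b"
proof (induction k)
  case (Suc k)
  have "norm (f ((f ^^ k) b)) \<le> K * norm ((f ^^ k) b)" by (rule assms)
  also have "\<dots> \<le> K * (K ^ k * norm b)" by (intro mult_left_mono Suc) (use assms in auto)
  finally show ?case by (simp add: mult_ac)
qed simp

text \<open>Comparing coefficients in the differential equation forces
  \<open>w (Suc i) = A *v w i\<close>, with \<open>b\<close> added at \<open>i = N\<close>; started
  at zero, this recursion has the closed form \<open>w\<close>.\<close>

lemma power_series_ode_solution:
  fixes A :: "real^'n^'n" and b :: "real^'n" and N :: nat
  defines "w \<equiv> \<lambda>i. if i \<le> N then 0 else (((*v) A) ^^ (i - Suc N)) b"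
  obtains X where "\<And>t. (\<lambda>i. (t ^ i / fact i) *\<^sub>R w i) sums X t"
    "\<And>t. (X has_vector_derivative A *v X t + (t ^ N / fact N) *\<^sub>R b) (at t)"
proof -
  define X where "X = (\<lambda>t. \<Sum>i. (t ^ i / fact i) *\<^sub>R w i)"
  obtain K where K: "K > 0" "\<And>x. norm (A *v x) \<le> K * norm x"
    using linear_bounded_pos[of "(*v) A"] by auto
  note pow = norm_funpow_bound[OF K(2,1)]
  \<comment> \<open>A base of at least 1 allows the exponent \<open>i - Suc N\<close> to be raised
    to \<open>i\<close>.\<close>
  define B where "B = max 1 K"
  have w: "norm (w i) \<le> B ^ i * norm b" for i
  proof (cases "i \<le> N")
    case False
    have "K ^ (i - Suc N) \<le> B ^ (i - Suc N)"
      unfolding B_def by (rule power_mono) (use K in auto)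
    also have "\<dots> \<le> B ^ i" unfolding B_def by (rule power_increasing) auto
    finally have "K ^ (i - Suc N) * norm b \<le> B ^ i * norm b"
      by (rule mult_right_mono) simp
    then show ?thesis using False order_trans[OF pow] by (simp add: w_def)
  qed (simp add: w_def B_def)
  have sums: "(\<lambda>i. (t ^ i / fact i) *\<^sub>R w i) sums X t" for t
  proof -
    have "summable (\<lambda>i. norm b * (inverse (fact i) * (B * \<bar>t\<bar>) ^ i))"
      by (intro summable_mult summable_exp)
    then have "summable (\<lambda>i. (t ^ i / fact i) *\<^sub>R w i)"
      by (rule summable_comparison_test[rotated])
        (use mult_right_mono[OF w, of "\<bar>t\<bar> ^ n" for n] in
          \<open>auto simp: power_abs power_mult_distrib field_simps\<close>)
    then show ?thesis unfolding X_def by (rule summable_sums)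
  qed
  have w_Suc: "w (Suc i) = A *v w i + (if i = N then b else 0)" for i
    by (cases i N rule: linorder_cases) (auto simp: w_def Suc_diff_Suc dest!: less_imp_Suc_add)
  have "(X has_vector_derivative A *v X t + (t ^ N / fact N) *\<^sub>R b) (at t)" for t
  proof -
    have "(\<lambda>i. A *v ((t ^ i / fact i) *\<^sub>R w i)) sums (A *v X t)"
      by (rule bounded_linear.sums[OF matrix_vector_mul_bounded_linear sums])
    moreover have "(\<lambda>i. if i = N then (t ^ N / fact N) *\<^sub>R b else 0) sums ((t ^ N / fact N) *\<^sub>R b)"
      by (rule sums_single)
    ultimately have "(\<lambda>i. A *v ((t ^ i / fact i) *\<^sub>R w i)
        + (if i = N then (t ^ N / fact N) *\<^sub>R b else 0)) sums (A *v X t + (t ^ N / fact N) *\<^sub>R b)"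
      by (rule sums_add)
    also have "(\<lambda>i. A *v ((t ^ i / fact i) *\<^sub>R w i) + (if i = N then (t ^ N / fact N) *\<^sub>R b else 0))
        = (\<lambda>i. (t ^ i / fact i) *\<^sub>R w (Suc i))"
      by (auto simp: w_Suc matrix_vector_mult_scaleR scaleR_add_right)
    finally have D: "(\<lambda>i. (t ^ i / fact i) *\<^sub>R w (Suc i)) sums (A *v X t + (t ^ N / fact N) *\<^sub>R b)" .
    have "((\<lambda>t. X t $ k) has_real_derivative (A *v X t + (t ^ N / fact N) *\<^sub>R b) $ k) (at t)" for k
    proof -
      define c where "c = (\<lambda>i. w i $ k / fact i)"
      have s: "(\<lambda>i. c i * t ^ i) sums (X t $ k)" for t
        using bounded_linear.sums[OF bounded_linear_vec_nth sums[of t], of k]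
        by (simp add: c_def mult_ac)
      have "((\<lambda>t. \<Sum>i. c i * t ^ i) has_real_derivative (\<Sum>i. diffs c i * t ^ i)) (at t)"
        by (rule termdiffs_strong_converges_everywhere) (use s in \<open>auto simp: sums_iff\<close>)
      also have "(\<lambda>t. \<Sum>i. c i * t ^ i) = (\<lambda>t. X t $ k)"
        using s by (auto simp: sums_iff)
      also have "(\<lambda>i. diffs c i * t ^ i) = (\<lambda>i. ((t ^ i / fact i) *\<^sub>R w (Suc i)) $ k)"
        by (simp add: diffs_def c_def mult_ac del: of_nat_Suc)
      also have "(\<Sum>i. ((t ^ i / fact i) *\<^sub>R w (Suc i)) $ k) = (A *v X t + (t ^ N / fact N) *\<^sub>R b) $ k"
        using bounded_linear.sums[OF bounded_linear_vec_nth D, of k] by (simp add: sums_iff)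
      finally show ?thesis .
    qed
    then show ?thesis
      by (simp add: has_vector_derivative_def has_field_derivative_def
          has_derivative_componentwise_within[of X] Basis_vec_def inner_axis mult_commute_abs)
  qed
  then show ?thesis using that sums by blast
qed

text \<open>Since \<open>fact q * fact j \<le> fact (q + j)\<close>, the leading monomial factors
  out and an exponential series remains, whose sum is independent of \<open>q\<close>.\<close>

lemma sums_shifted_factorial_powers_bound:
  fixes v :: "nat \<Rightarrow> 'a::banach"
  assumes s: "(\<lambda>j. (t ^ (q + j) / fact (q + j)) *\<^sub>R v j) sums R"
    and v: "\<And>j. norm (v j) \<le> C * K ^ j" and K: "K \<ge> 0" and t: "0 \<le> t" "t \<le> T"
  shows "norm R \<le> t ^ q / fact q * (C * exp (K * T))"
proof -
  have C: "C \<ge> 0" using v[of 0] norm_ge_zero[of "v 0"] by (simp del: norm_ge_zero)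
  have b: "norm ((t ^ (q + j) / fact (q + j)) *\<^sub>R v j)
      \<le> t ^ q / fact q * (C * ((K * T) ^ j /\<^sub>R fact j))" for j
  proof -
    have "fact q * fact j \<le> (fact (q + j) :: real)"
      using dvd_imp_le[OF fact_fact_dvd_fact[of q j]] fact_gt_zero
      by (metis of_nat_fact of_nat_le_iff of_nat_mult)
    then have "t ^ (q + j) / fact (q + j) \<le> t ^ (q + j) / (fact q * fact j)"
      using t by (intro divide_left_mono) auto
    also have "\<dots> \<le> t ^ q * T ^ j / (fact q * fact j)"
      using t by (auto simp: power_add intro!: divide_right_mono mult_left_mono power_mono)
    finally have "t ^ (q + j) / fact (q + j) * norm (v j)
        \<le> t ^ q * T ^ j / (fact q * fact j) * (C * K ^ j)"
      by (rule mult_mono[OF _ v]) (use t in auto)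
    then show ?thesis using t by (simp add: field_simps power_mult_distrib)
  qed
  have e: "(\<lambda>j. t ^ q / fact q * (C * ((K * T) ^ j /\<^sub>R fact j))) sums (t ^ q / fact q * (C * exp (K * T)))"
    by (intro sums_mult exp_converges)
  have "norm (\<Sum>j. (t ^ (q + j) / fact (q + j)) *\<^sub>R v j)
      \<le> (\<Sum>j. t ^ q / fact q * (C * ((K * T) ^ j /\<^sub>R fact j)))"
    by (rule norm_suminf_le[OF b sums_summable[OF e]])
  then show ?thesis using s e by (simp add: sums_iff)
qed

section \<open>Graph distance and relative degree\<close>

text \<open>A shortest path meets every smaller distance, so \<open>d + 1\<close> different values
  occur among the vertices. The bound on \<open>d\<close> provides the upper limit in the definition
  of relative degree.\<close>

lemma ex_least_relpow_witness:
  fixes E :: "('n::finite \<times> 'n) set"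
  assumes "(a, m) \<in> E\<^sup>*"
  obtains d where "(a, m) \<in> E ^^ d" "\<And>k. k < d \<Longrightarrow> (a, m) \<notin> E ^^ k" "d < CARD('n)"
proof -
  \<comment> \<open>For an unreachable vertex the value is arbitrary; this is harmless, since only
    the size of the range is bounded from above.\<close>
  define dist where "dist = (\<lambda>i. LEAST k. (a, i) \<in> E ^^ k)"
  have D: "(a, i) \<in> E ^^ dist i" if "(a, i) \<in> E ^^ k" for i k
    using that unfolding dist_def by (rule LeastI)
  have le: "dist i \<le> k" if "(a, i) \<in> E ^^ k" for i k
    using that unfolding dist_def by (rule Least_le)
  obtain k where "(a, m) \<in> E ^^ k" using assms rtrancl_imp_relpow by blast
  note m = D[OF this]
  have "{0..dist m} \<subseteq> range dist"
  proof -
    have "\<exists>i. (a, i) \<in> E ^^ k \<and> dist i = k" if "k \<le> dist m" for k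
      using that
    proof (induction rule: inc_induct)
      case base
      then show ?case using m by blast
    next
      case (step k)
      then obtain i where i: "(a, i) \<in> E ^^ Suc k" "dist i = Suc k" by blast
      then obtain j where j: "(a, j) \<in> E ^^ k" "(j, i) \<in> E" by auto
      have "(a, i) \<in> E ^^ Suc (dist j)" using D[OF j(1)] j(2) by auto
      from le[OF this] have "Suc k \<le> Suc (dist j)" using i(2) by simp
      then show ?case using le[OF j(1)] j(1) by auto
    qed
    then show ?thesis by force
  qed
  then have "card {0..dist m} \<le> card (range dist)" by (intro card_mono) auto
  also have "\<dots> \<le> CARD('n)" by (rule card_image_le) simp
  finally have "dist m < CARD('n)" by simp
  then show ?thesis using that[OF m] le by (meson leD)
qed

text \<open>The diagonal of \<open>Q\<close> may have any sign, but it cannot interfere: at a vertex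
  not reached in fewer than \<open>k\<close> steps, a diagonal entry only multiplies an entry that
  is still zero. All other contributions are nonnegative, so nothing cancels.\<close>

lemma funpow_entry_graph_distance:
  fixes Q :: "real^'n^'n"
  assumes pos: "\<And>i j. (i, j) \<in> E \<Longrightarrow> i \<noteq> j \<Longrightarrow> Q $ j $ i > 0"
    and zero: "\<And>i j. (i, j) \<notin> E \<Longrightarrow> i \<noteq> j \<Longrightarrow> Q $ j $ i = 0"
    and "\<And>l. l < k \<Longrightarrow> (a, j) \<notin> E ^^ l"
  shows "(((*v) Q) ^^ k) (axis a 1) $ j \<ge> 0 \<and>
    ((((*v) Q) ^^ k) (axis a 1) $ j > 0 \<longleftrightarrow> (a, j) \<in> E ^^ k)"
  using assms(3)
proof (induction k arbitrary: j)
  case 0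
  then show ?case by (auto simp: axis_def)
next
  case (Suc k)
  let ?v = "(((*v) Q) ^^ k) (axis a 1)"
  have vj: "?v $ j = 0"
    using Suc.IH[of j] Suc.prems by (force simp: less_Suc_eq not_less order_le_less)
  have nn: "Q $ j $ i * ?v $ i \<ge> 0 \<and> (Q $ j $ i * ?v $ i > 0 \<longleftrightarrow> (a, i) \<in> E ^^ k \<and> (i, j) \<in> E)" for i
  proof (cases "i = j")
    case True
    then show ?thesis using vj Suc.prems[of k] by auto
  next
    case False
    show ?thesis
    proof (cases "(i, j) \<in> E")
      case True
      \<comment> \<open>A shorter walk to the neighbour \<open>i\<close> would extend to a walk to
        \<open>j\<close> that is too short.\<close>
      have "(a, i) \<notin> E ^^ l" if "l < k" for l
        using Suc.prems[of "Suc l"] True that by auto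
      from Suc.IH[OF this] show ?thesis
        using pos[OF True False] True by (simp add: zero_less_mult_iff)
    qed (simp add: zero False)
  qed
  have e: "(((*v) Q) ^^ Suc k) (axis a 1) $ j = (\<Sum>i\<in>UNIV. Q $ j $ i * ?v $ i)"
    by (simp add: matrix_vector_mult_def)
  have "(\<Sum>i\<in>UNIV. Q $ j $ i * ?v $ i) > 0 \<longleftrightarrow> (\<exists>i. Q $ j $ i * ?v $ i > 0)"
    using sum_nonneg_eq_0_iff[of UNIV "\<lambda>i. Q $ j $ i * ?v $ i"] sum_nonneg[of UNIV "\<lambda>i. Q $ j $ i * ?v $ i"] nn
    by (smt (verit) UNIV_I finite)
  also have "\<dots> \<longleftrightarrow> (a, j) \<in> E ^^ Suc k" using nn by auto
  finally show ?case unfolding e using nn by (auto intro: sum_nonneg)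
qed

text \<open>Off the diagonal, the negated looped Laplacian is the adjacency matrix, so the first
  power that carries the input from \<open>a\<close> to \<open>m\<close> is the distance
  \<open>d\<close>, and the relative degree is \<open>Suc d\<close>. This makes the definite
  description in \<open>relative_degree\<close> meaningful.\<close>

lemma looped_laplacian_has_relative_degree:
  fixes A :: "real^'n::finite^'n"
  assumes "connected_weighted_graph E A"
  shows "has_relative_degree (- looped_laplacian A \<theta>) (axis a 1) (axis m 1)
    (relative_degree (- looped_laplacian A \<theta>) (axis a 1) (axis m 1))"
proof -
  let ?Q = "- looped_laplacian A \<theta>"
  have offdiag: "?Q $ j $ i = A $ i $ j" if "i \<noteq> j" for i j
  proof -
    have "A $ j $ i = transpose A $ i $ j" by (simp add: transpose_def)
    also have "\<dots> = A $ i $ j" using assms by (simp add: connected_weighted_graph_def)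
    finally show ?thesis using that
      by (simp add: looped_laplacian_def laplacian_def diag_matrix_def)
  qed
  have pos: "?Q $ j $ i > 0" if "(i, j) \<in> E" "i \<noteq> j" for i j
    using assms offdiag[OF that(2)] that by (simp add: connected_weighted_graph_def)
  have zero: "?Q $ j $ i = 0" if "(i, j) \<notin> E" "i \<noteq> j" for i j
    using assms offdiag[OF that(2)] that by (simp add: connected_weighted_graph_def)
  have "(a, m) \<in> E\<^sup>*" using assms by (simp add: connected_weighted_graph_def)
  then obtain d where d: "(a, m) \<in> E ^^ d" "\<And>k. k < d \<Longrightarrow> (a, m) \<notin> E ^^ k" "d < CARD('n)"
    using ex_least_relpow_witness by blast
  have entry: "(((*v) ?Q) ^^ k) (axis a 1) $ m \<ge> 0 \<and>
      ((((*v) ?Q) ^^ k) (axis a 1) $ m > 0 \<longleftrightarrow> (a, m) \<in> E ^^ k)" if "k \<le> d" for k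
    by (rule funpow_entry_graph_distance) (use pos zero d(2) that in auto)
  have "axis m 1 \<bullet> (((*v) ?Q) ^^ k) (axis a 1) = 0" if "k < d" for k
    using entry[of k] d(2)[OF that] that by (simp add: inner_axis')
  moreover have "axis m 1 \<bullet> (((*v) ?Q) ^^ d) (axis a 1) \<noteq> 0"
    using entry[of d] d(1) by (simp add: inner_axis')
  ultimately have r: "has_relative_degree ?Q (axis a 1) (axis m 1) (Suc d)"
    using d(3) by (simp add: has_relative_degree_def matrix_power_mult_vector)
  show ?thesis
    unfolding relative_degree_def by (rule theI) (fact r, rule has_relative_degree_unique[OF _ r])
qed

section \<open>Bounding one output by the other\<close>

lemma output_bounded_by_lower_degree_output:
  fixes Q :: "real^'n^'n" and b c d :: "real^'n"
  assumes c: "\<And>k. k < p \<Longrightarrow> c \<bullet> (((*v) Q) ^^ k) b = 0" "c \<bullet> (((*v) Q) ^^ p) b \<noteq> 0"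
    and d: "\<And>k. k < p \<Longrightarrow> d \<bullet> (((*v) Q) ^^ k) b = 0"
    and T: "T > 0"
  obtains C where "C \<ge> 0"
    "\<And>u x. is_trajectory Q b u x \<Longrightarrow> x 0 = 0 \<Longrightarrow>
      L2_norm_sq T (\<lambda>t. d \<bullet> x t) \<le> ennreal C * L2_norm_sq T (\<lambda>t. c \<bullet> x t)"
proof -
  obtain S P q \<kappa> where S: "linear S" and P: "linear P" and Sb: "S b = 0"
    and SQ: "\<And>x. S (Q *v x) = P (S x) + (c \<bullet> x) *\<^sub>R q"
    and dS: "\<And>x. d \<bullet> x = d \<bullet> S x + \<kappa> * (c \<bullet> x)"
    using output_driven_reduction[OF matrix_vector_mul_linear c d] by blast
  obtain G where G: "G \<ge> 0"
    "\<And>\<xi> v t. \<lbrakk>\<And>t. t \<in> {0..T} \<Longrightarrow>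
        (\<xi> has_vector_derivative P (\<xi> t) + v t *\<^sub>R q) (at t within {0..T});
      continuous_on {0..T} v; \<xi> 0 = 0; t \<in> {0..T}\<rbrakk>
      \<Longrightarrow> (norm (\<xi> t))\<^sup>2 \<le> G * integral {0..T} (\<lambda>s. (v s)\<^sup>2)"
    using linear_ode_gronwall[OF P, of T q] by blast
  \<comment> \<open>From the square of a sum being at most twice the sum of squares: the first term
    integrates the pointwise Gronwall bound over the horizon, the second comes from the direct term
    \<open>\<kappa>\<close>.\<close>
  define C where "C = 2 * (norm d)\<^sup>2 * G * T + 2 * \<kappa>\<^sup>2"
  have C: "C \<ge> 0" using G(1) T by (simp add: C_def)
  have "L2_norm_sq T (\<lambda>t. d \<bullet> x t) \<le> ennreal C * L2_norm_sq T (\<lambda>t. c \<bullet> x t)"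
    if x: "is_trajectory Q b u x" and x0: "x 0 = 0" for u x
  proof -
    have cx: "continuous_on {0..T} x" by (rule trajectory_continuous[OF x])
    have cS: "continuous_on {0..T} (\<lambda>t. S (x t))"
      by (rule linear_continuous_on_compose[OF cx S])
    have cP: "continuous_on {0..T} (\<lambda>t. P (S (x t)))"
      by (rule linear_continuous_on_compose[OF cS P])
    let ?v = "\<lambda>t. c \<bullet> x t"
    let ?V = "integral {0..T} (\<lambda>t. (?v t)\<^sup>2)"
    have cv: "continuous_on {0..T} ?v" by (intro continuous_intros cx)
    let ?h = "\<lambda>t. P (S (x t)) + ?v t *\<^sub>R q"
    have ch: "continuous_on {0..T} ?h" by (intro continuous_intros cP cv)
    \<comment> \<open>Applying \<open>S\<close> to the integral equation removes the input, as
      \<open>S b = 0\<close>. The new integrand is continuous, so \<open>S (x t)\<close> is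
      differentiable even where \<open>x\<close> is not.\<close>
    have int: "(?h has_integral S (x t)) {0..t}" if "t \<ge> 0" for t
    proof -
      have "((\<lambda>s. Q *v x s + u s *\<^sub>R b) has_integral x t) {0..t}"
        using x x0 that by (simp add: is_trajectory_def)
      from has_integral_linear[OF this linear_conv_bounded_linear[THEN iffD1, OF S]]
      show ?thesis
        by (simp add: o_def linear_add[OF S] linear_scale[OF S] Sb SQ)
    qed
    have I: "S (x t) = integral {0..t} ?h" if "t \<in> {0..T}" for t
      using integral_unique[OF int[of t]] that by simp
    have der: "((\<lambda>t. S (x t)) has_vector_derivative ?h t) (at t within {0..T})"
      if "t \<in> {0..T}" for t
      by (rule has_vector_derivative_transform[OF that _ integral_has_vector_derivative[OF ch that]])
        (rule I)
    have \<xi>: "(norm (S (x t)))\<^sup>2 \<le> G * ?V" if "t \<in> {0..T}" for t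
      by (rule G(2)[OF der cv _ that]) (simp_all add: x0 linear_0[OF S])
    have pt: "(d \<bullet> x t)\<^sup>2 \<le> 2 * (norm d)\<^sup>2 * (G * ?V) + 2 * \<kappa>\<^sup>2 * (?v t)\<^sup>2"
      if "t \<in> {0..T}" for t
    proof -
      have "(d \<bullet> x t)\<^sup>2 \<le> 2 * (d \<bullet> S (x t))\<^sup>2 + 2 * (\<kappa> * ?v t)\<^sup>2"
        using sum_squares_bound[of "d \<bullet> S (x t)" "\<kappa> * ?v t"]
        unfolding dS[of "x t"] power2_sum by simp
      also have "(d \<bullet> S (x t))\<^sup>2 \<le> (norm d)\<^sup>2 * (norm (S (x t)))\<^sup>2"
        using Cauchy_Schwarz_ineq[of d "S (x t)"] by (simp add: power2_norm_eq_inner)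
      also have "\<dots> \<le> (norm d)\<^sup>2 * (G * ?V)"
        by (intro mult_left_mono \<xi> that) simp
      finally show ?thesis by (simp add: power_mult_distrib)
    qed
    have cd: "continuous_on {0..T} (\<lambda>t. d \<bullet> x t)" by (intro continuous_intros cx)
    have cr: "continuous_on {0..T} (\<lambda>t. 2 * (norm d)\<^sup>2 * (G * ?V) + 2 * \<kappa>\<^sup>2 * (?v t)\<^sup>2)"
      by (intro continuous_intros cv)
    have "integral {0..T} (\<lambda>t. (d \<bullet> x t)\<^sup>2)
        \<le> integral {0..T} (\<lambda>t. 2 * (norm d)\<^sup>2 * (G * ?V) + 2 * \<kappa>\<^sup>2 * (?v t)\<^sup>2)"
      by (rule integral_le) (use pt in \<open>auto intro!: integrable_continuous_real cr continuous_intros cx\<close>)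
    also have "\<dots> = C * ?V"
      using T by (subst integral_add)
        (auto intro!: integrable_continuous_real continuous_intros cx simp: C_def algebra_simps)
    finally have "integral {0..T} (\<lambda>t. (d \<bullet> x t)\<^sup>2) / T \<le> C * (?V / T)"
      using T by (simp add: divide_right_mono)
    then show ?thesis
      using C by (simp add: L2_norm_sq_continuous[OF T cd] L2_norm_sq_continuous[OF T cv]
        ennreal_mult'[symmetric] ennreal_leI)
  qed
  then show ?thesis using that C by blast
qed

section \<open>Responses to monomial inputs\<close>

lemma trajectory_scale:
  assumes "is_trajectory Q b u x"
  shows "is_trajectory Q b (\<lambda>t. k * u t) (\<lambda>t. k *\<^sub>R x t)"
  unfolding is_trajectory_def
proof (intro allI impI)
  fix t :: real assume "t \<ge> 0"
  then have "((\<lambda>s. Q *v x s + u s *\<^sub>R b) has_integral (x t - x 0)) {0..t}"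
    using assms by (simp add: is_trajectory_def)
  from has_integral_cmul[OF this, of k]
  show "((\<lambda>s. Q *v k *\<^sub>R x s + (k * u s) *\<^sub>R b) has_integral k *\<^sub>R x t - k *\<^sub>R x 0) {0..t}"
    by (simp add: scaleR_diff_right scaleR_add_right matrix_vector_mult_scaleR)
qed

lemma continuous_in_L2e: "continuous_on UNIV u \<Longrightarrow> u \<in> L2e"
  using continuous_on_subset[of UNIV u]
  by (auto simp: L2e_def L2_norm_sq_continuous intro!: continuous_imp_measurable_on_sets_lebesgue)

text \<open>An output whose first \<open>p\<close> Markov parameters vanish begins with the power
  \<open>N + p + 1\<close>. \<open>C\<close> depends neither on \<open>N\<close> nor on
  \<open>e\<close>, so \<open>N\<close> can later be chosen in terms of \<open>C\<close> and both
  outputs can share one input.\<close>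

lemma monomial_input_output_expansion:
  fixes Q :: "real^'n^'n" and b :: "real^'n"
  obtains C where "C \<ge> 0"
    "\<And>N. \<exists>x. is_trajectory Q b (\<lambda>t. t ^ N / fact N) x \<and> x 0 = 0 \<and>
      (\<forall>e. (\<forall>k<p. e \<bullet> (((*v) Q) ^^ k) b = 0) \<longrightarrow> (\<forall>t\<in>{0..T}.
        \<bar>e \<bullet> x t - t ^ (N + p + 1) / fact (N + p + 1) * (e \<bullet> (((*v) Q) ^^ p) b)\<bar>
          \<le> t ^ (N + p + 2) / fact (N + p + 2) * (norm e * C)))"
proof -
  obtain K where K: "K > 0" "\<And>x. norm (Q *v x) \<le> K * norm x"
    using linear_bounded_pos[of "(*v) Q"] by auto
  define C where "C = K ^ Suc p * norm b * exp (K * T)"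
  have "\<exists>x. is_trajectory Q b (\<lambda>t. t ^ N / fact N) x \<and> x 0 = 0 \<and>
      (\<forall>e. (\<forall>k<p. e \<bullet> (((*v) Q) ^^ k) b = 0) \<longrightarrow> (\<forall>t\<in>{0..T}.
        \<bar>e \<bullet> x t - t ^ (N + p + 1) / fact (N + p + 1) * (e \<bullet> (((*v) Q) ^^ p) b)\<bar>
          \<le> t ^ (N + p + 2) / fact (N + p + 2) * (norm e * C)))" for N
  proof -
    let ?w = "\<lambda>i. if i \<le> N then 0 else (((*v) Q) ^^ (i - Suc N)) b"
    obtain X where X: "\<And>t. (\<lambda>i. (t ^ i / fact i) *\<^sub>R ?w i) sums X t"
      and X': "\<And>t. (X has_vector_derivative Q *v X t + (t ^ N / fact N) *\<^sub>R b) (at t)"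
      using power_series_ode_solution[where A = Q and b = b and N = N] by blast
    have "is_trajectory Q b (\<lambda>t. t ^ N / fact N) X"
      unfolding is_trajectory_def
      by (auto intro!: fundamental_theorem_of_calculus has_vector_derivative_at_within[OF X'])
    moreover have "X 0 = 0"
    proof -
      have "(\<lambda>i. (0 ^ i / fact i) *\<^sub>R ?w i) = (\<lambda>_. 0)"
        by (auto simp: fun_eq_iff power_0_left)
      then show ?thesis using X[of 0] by (simp only: sums_iff suminf_zero)
    qed
    moreover have "\<bar>e \<bullet> X t - t ^ (N + p + 1) / fact (N + p + 1) * (e \<bullet> (((*v) Q) ^^ p) b)\<bar>
          \<le> t ^ (N + p + 2) / fact (N + p + 2) * (norm e * C)"
      if e: "\<forall>k<p. e \<bullet> (((*v) Q) ^^ k) b = 0" and t: "t \<in> {0..T}" for e t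
    proof -
      let ?f = "\<lambda>i. (t ^ i / fact i) * (e \<bullet> ?w i)"
      let ?q = "N + p + 2"
      have "?f sums (e \<bullet> X t)"
        using bounded_linear.sums[OF bounded_linear_inner_right X, of e t] by simp
      then have "(\<lambda>i. ?f (i + ?q)) sums (e \<bullet> X t - (\<Sum>i<?q. ?f i))"
        by (rule sums_split_initial_segment)
      also have "(\<Sum>i<?q. ?f i) = t ^ (N + p + 1) / fact (N + p + 1) * (e \<bullet> (((*v) Q) ^^ p) b)"
      proof -
        \<comment> \<open>Indices up to \<open>N\<close> vanish by the definition of the
          coefficients, the next \<open>p\<close> by the assumption on \<open>e\<close>.\<close>
        have "(\<Sum>i<N + p + 1. ?f i) = 0"
          using e by (intro sum.neutral) (auto simp: less_Suc_eq_le)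
        then show ?thesis by simp
      qed
      also have "(\<lambda>i. ?f (i + ?q))
          = (\<lambda>j. (t ^ (?q + j) / fact (?q + j)) *\<^sub>R (e \<bullet> (((*v) Q) ^^ (Suc p + j)) b))"
        by (simp add: add_ac)
      finally have s: "(\<lambda>j. (t ^ (?q + j) / fact (?q + j)) *\<^sub>R (e \<bullet> (((*v) Q) ^^ (Suc p + j)) b))
        sums (e \<bullet> X t - t ^ (N + p + 1) / fact (N + p + 1) * (e \<bullet> (((*v) Q) ^^ p) b))" .
      have "norm (e \<bullet> (((*v) Q) ^^ (Suc p + j)) b) \<le> (norm e * (K ^ Suc p * norm b)) * K ^ j" for j
      proof -
        have "norm (e \<bullet> (((*v) Q) ^^ (Suc p + j)) b) \<le> norm e * norm ((((*v) Q) ^^ (Suc p + j)) b)"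
          unfolding real_norm_def by (rule Cauchy_Schwarz_ineq2)
        also have "\<dots> \<le> norm e * (K ^ (Suc p + j) * norm b)"
          by (intro mult_left_mono norm_funpow_bound K) auto
        finally show ?thesis by (simp add: power_add mult_ac)
      qed
      from sums_shifted_factorial_powers_bound[OF s this, of T]
      show ?thesis using K t by (simp add: C_def mult_ac)
    qed
    ultimately show ?thesis by blast
  qed
  moreover have "C \<ge> 0" using K by (simp add: C_def)
  ultimately show ?thesis using that by blast
qed

text \<open>In the shared expansion the leading term of \<open>c\<close> is zero, so
  \<open>c\<close> retains only the remainder, while \<open>d\<close> is dominated by its leading
  term.\<close>

lemma output_unbounded_by_higher_degree_output:
  fixes Q :: "real^'n^'n" and b c d :: "real^'n"
  assumes c: "\<And>k. k \<le> p \<Longrightarrow> c \<bullet> (((*v) Q) ^^ k) b = 0"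
    and d: "\<And>k. k < p \<Longrightarrow> d \<bullet> (((*v) Q) ^^ k) b = 0" "d \<bullet> (((*v) Q) ^^ p) b \<noteq> 0"
    and T: "T > 0" and \<delta>: "\<delta> > 0" and R: "R > 0"
  obtains u x where "u \<in> L2e" "is_trajectory Q b u x" "x 0 = 0"
    "L2_norm_sq T (\<lambda>t. c \<bullet> x t) \<le> ennreal \<delta>" "L2_norm_sq T (\<lambda>t. d \<bullet> x t) \<ge> ennreal R"
proof -
  define g where "g = \<bar>d \<bullet> (((*v) Q) ^^ p) b\<bar> / 2"
  have g: "g > 0" using d by (simp add: g_def)
  obtain C where C: "C \<ge> 0" and ex: 
    "\<And>N. \<exists>x. is_trajectory Q b (\<lambda>t. t ^ N / fact N) x \<and> x 0 = 0 \<and>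
      (\<forall>e. (\<forall>k<p. e \<bullet> (((*v) Q) ^^ k) b = 0) \<longrightarrow> (\<forall>t\<in>{0..T}.
        \<bar>e \<bullet> x t - t ^ (N + p + 1) / fact (N + p + 1) * (e \<bullet> (((*v) Q) ^^ p) b)\<bar>
          \<le> t ^ (N + p + 2) / fact (N + p + 2) * (norm e * C)))"
    using monomial_input_output_expansion[of Q b p T] by blast
  define H where "H = C * (norm c + norm d) * T"
  have H: "H \<ge> 0" using C T by (simp add: H_def)
  \<comment> \<open>The bound \<open>g\<close> lets the remainder consume at most half of the
    leading term of \<open>d\<close>; the other bound keeps the energy ratio of the two outputs
    below \<open>\<delta> / R\<close>.\<close>
  define \<eta> where "\<eta> = min g (g * sqrt (\<delta> / R))"
  have \<eta>: "\<eta> > 0" using g \<delta> R by (simp add: \<eta>_def)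
  obtain N :: nat where N: "H / \<eta> \<le> real N" using real_arch_simple by blast
  define q where "q = N + p + 1"
  define F where "F = (\<lambda>t::real. t ^ q / fact q)"
  have e: "C * (norm c + norm d) * T / real (q + 1) \<le> \<eta>"
  proof -
    have "H \<le> \<eta> * real N" using N \<eta> by (simp add: field_simps)
    also have "\<dots> \<le> \<eta> * real (q + 1)" using \<eta> by (intro mult_left_mono) (auto simp: q_def)
    finally show ?thesis by (simp add: H_def divide_simps)
  qed
  obtain x where x: "is_trajectory Q b (\<lambda>t. t ^ N / fact N) x" "x 0 = 0"
    and xe: "\<And>e t. (\<And>k. k < p \<Longrightarrow> e \<bullet> (((*v) Q) ^^ k) b = 0) \<Longrightarrow> t \<in> {0..T} \<Longrightarrow>
        \<bar>e \<bullet> x t - F t * (e \<bullet> (((*v) Q) ^^ p) b)\<bar>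
          \<le> t ^ (q + 1) / fact (q + 1) * (norm e * C)"
    using ex[of N] by (auto simp: q_def F_def)
  have rem: "t ^ (q + 1) / fact (q + 1) * (norm e * C) \<le> F t * \<eta>"
    if "t \<in> {0..T}" "norm e \<le> norm c + norm d" for e :: "real^'n" and t
  proof -
    have F: "F t \<ge> 0" using that by (simp add: F_def)
    have "t ^ (q + 1) / fact (q + 1) * (norm e * C) = F t * (C * norm e * t / real (q + 1))"
      by (simp add: F_def mult_ac)
    also have "\<dots> \<le> F t * (C * (norm c + norm d) * T / real (q + 1))"
      using that C F by (intro mult_left_mono divide_right_mono mult_mono) auto
    also have "\<dots> \<le> F t * \<eta>" by (rule mult_left_mono[OF e F])
    finally show ?thesis .
  qed
  have small: "(c \<bullet> x t)\<^sup>2 \<le> \<eta>\<^sup>2 * (F t)\<^sup>2" if "t \<in> {0..T}" for t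
  proof -
    have "\<bar>c \<bullet> x t\<bar> \<le> F t * \<eta>"
      using order_trans[OF xe rem, of c t] c that by simp
    then have "(c \<bullet> x t)\<^sup>2 \<le> (F t * \<eta>)\<^sup>2" by (simp add: power2_le_iff_abs_le abs_le_square_iff[symmetric])
    then show ?thesis by (simp add: power_mult_distrib mult.commute)
  qed
  have large: "g\<^sup>2 * (F t)\<^sup>2 \<le> (d \<bullet> x t)\<^sup>2" if "t \<in> {0..T}" for t
  proof -
    have F: "F t \<ge> 0" using that by (simp add: F_def)
    have "\<bar>d \<bullet> x t - F t * (d \<bullet> (((*v) Q) ^^ p) b)\<bar> \<le> F t * \<eta>"
      using order_trans[OF xe rem, of d t] d that by simp
    also have "\<dots> \<le> F t * g" using F by (intro mult_left_mono) (auto simp: \<eta>_def)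
    finally have "\<bar>F t * (d \<bullet> (((*v) Q) ^^ p) b)\<bar> - F t * g \<le> \<bar>d \<bullet> x t\<bar>" by linarith
    then have "g * F t \<le> \<bar>d \<bullet> x t\<bar>"
      using F by (simp add: abs_mult g_def algebra_simps)
    then have "(g * F t)\<^sup>2 \<le> \<bar>d \<bullet> x t\<bar>\<^sup>2" using g F by (intro power_mono) auto
    then show ?thesis by (simp add: power_mult_distrib)
  qed
  define s where "s = integral {0..T} (\<lambda>t. (F t)\<^sup>2)"
  have cF: "continuous_on {0..T} (\<lambda>t. (F t)\<^sup>2)" unfolding F_def by (intro continuous_intros) auto
  have "s \<ge> 0" unfolding s_def by (intro integral_nonneg integrable_continuous_real cF) auto
  moreover have "s \<noteq> 0"
  proof
    assume "s = 0"
    then have "\<forall>t\<in>{0..T}. (F t)\<^sup>2 = 0"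
      using integral_eq_0_iff[OF cF] T by (simp add: s_def)
    then show False using T by (auto simp: F_def dest!: bspec[of _ _ T])
  qed
  ultimately have s: "s > 0" by simp
  \<comment> \<open>Chosen so that the lower bound on the scaled output \<open>d\<close> becomes
    exactly \<open>R\<close>.\<close>
  define \<kappa> where "\<kappa> = sqrt (R * T / (g\<^sup>2 * s))"
  have \<kappa>: "\<kappa>\<^sup>2 = R * T / (g\<^sup>2 * s)" using R T s by (simp add: \<kappa>_def)
  have cx: "continuous_on {0..T} x" by (rule trajectory_continuous[OF x(1)])
  have L2: "L2_norm_sq T (\<lambda>t. e \<bullet> \<kappa> *\<^sub>R x t)
      = ennreal (\<kappa>\<^sup>2 * integral {0..T} (\<lambda>t. (e \<bullet> x t)\<^sup>2) / T)" for e
    by (subst L2_norm_sq_continuous[OF T]) (auto intro!: continuous_intros cx simp: power_mult_distrib)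
  have int: "(\<lambda>t. (e \<bullet> x t)\<^sup>2) integrable_on {0..T}" for e
    by (intro integrable_continuous_real continuous_intros cx)
  have intF: "(\<lambda>t. k * (F t)\<^sup>2) integrable_on {0..T}" for k
    by (intro integrable_continuous_real continuous_intros cF)
  show ?thesis
  proof (rule that)
    show "(\<lambda>t. \<kappa> * (t ^ N / fact N)) \<in> L2e"
      by (intro continuous_in_L2e continuous_intros) auto
    show "is_trajectory Q b (\<lambda>t. \<kappa> * (t ^ N / fact N)) (\<lambda>t. \<kappa> *\<^sub>R x t)"
      by (rule trajectory_scale[OF x(1)])
    show "\<kappa> *\<^sub>R x 0 = 0" using x by simp
    have "integral {0..T} (\<lambda>t. (c \<bullet> x t)\<^sup>2) \<le> \<eta>\<^sup>2 * s"
      using integral_le[OF int intF small] by (simp add: s_def)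
    then have "\<kappa>\<^sup>2 * integral {0..T} (\<lambda>t. (c \<bullet> x t)\<^sup>2) / T \<le> \<kappa>\<^sup>2 * (\<eta>\<^sup>2 * s) / T"
      using T by (intro divide_right_mono mult_left_mono) auto
    also have "\<dots> = \<eta>\<^sup>2 * R / g\<^sup>2" using T s g by (simp add: \<kappa> field_simps)
    also have "\<dots> \<le> (g * sqrt (\<delta> / R))\<^sup>2 * R / g\<^sup>2"
      using R \<eta> by (intro divide_right_mono mult_right_mono power_mono) (auto simp: \<eta>_def)
    also have "\<dots> = \<delta>" using R g \<delta> by (simp add: power_mult_distrib)
    finally show "L2_norm_sq T (\<lambda>t. c \<bullet> \<kappa> *\<^sub>R x t) \<le> ennreal \<delta>"
      unfolding L2 by (rule ennreal_leI)
    have "g\<^sup>2 * s \<le> integral {0..T} (\<lambda>t. (d \<bullet> x t)\<^sup>2)"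
      using integral_le[OF intF int large] by (simp add: s_def)
    then have "\<kappa>\<^sup>2 * (g\<^sup>2 * s) / T \<le> \<kappa>\<^sup>2 * integral {0..T} (\<lambda>t. (d \<bullet> x t)\<^sup>2) / T"
      using T by (intro divide_right_mono mult_left_mono) auto
    moreover have "\<kappa>\<^sup>2 * (g\<^sup>2 * s) / T = R" using T s g by (simp add: \<kappa> field_simps)
    ultimately show "L2_norm_sq T (\<lambda>t. d \<bullet> \<kappa> *\<^sub>R x t) \<ge> ennreal R"
      unfolding L2 by (intro ennreal_leI) simp
  qed
qed

section \<open>Boundedness of the worst-case impact\<close>

theorem theorem1:
  fixes E :: "('n::finite \<times> 'n) set"
    and A :: "real^'n^'n"
    and \<theta> :: "real^'n"
    and \<delta> :: "'n \<Rightarrow> real"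
    and T :: real
    and a \<rho> :: 'n
    and M :: "'n set"
  assumes graph: "connected_weighted_graph E A"
    and gains: "\<And>i. \<theta> $ i > 0"
    and thresholds: "\<And>m. \<delta> m > 0"
    and horizon: "T > 0"
    and no_unstable_zeros:
      "\<And>i m z. invariant_zero (- looped_laplacian A \<theta>) (axis i 1) (axis m 1) z \<Longrightarrow> \<not> Re z > 0"
    and "a \<noteq> \<rho>"
    and "M \<noteq> {}"
  shows "worst_case_impact T (looped_laplacian A \<theta>) \<delta> \<rho> a M < \<infinity> \<longleftrightarrow>
    (\<exists>m\<in>M. relative_degree (- looped_laplacian A \<theta>) (axis a 1) (axis m 1)
            \<le> relative_degree (- looped_laplacian A \<theta>) (axis a 1) (axis \<rho> 1))"
proof -
  let ?Q = "- looped_laplacian A \<theta>"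
  let ?r = "\<lambda>m. relative_degree ?Q (axis a 1) (axis m 1)"
  let ?J = "\<lambda>m. {L2_norm_sq T (\<lambda>t. axis \<rho> 1 \<bullet> x t) | \<zeta> x.
                      \<zeta> \<in> L2e \<and> is_trajectory ?Q (axis a 1) \<zeta> x \<and> x 0 = 0 \<and>
                      L2_norm_sq T (\<lambda>t. axis m 1 \<bullet> x t) \<le> ennreal (\<delta> m)}"
  have r: "?r m \<ge> 1" "\<And>k. k < ?r m - 1 \<Longrightarrow> axis m 1 \<bullet> (((*v) ?Q) ^^ k) (axis a 1) = 0"
    "axis m 1 \<bullet> (((*v) ?Q) ^^ (?r m - 1)) (axis a 1) \<noteq> 0" for m
    using looped_laplacian_has_relative_degree[OF graph, of \<theta> a m]
    by (simp_all add: has_relative_degree_def matrix_power_mult_vector)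
  \<comment> \<open>A minimum over a finite set is finite exactly when one of its members is, so
    each monitored vertex can be settled separately.\<close>
  have fin_iff: "Sup (?J m) < \<infinity> \<longleftrightarrow> ?r m \<le> ?r \<rho>" for m
  proof
    assume le: "?r m \<le> ?r \<rho>"
    have "axis \<rho> 1 \<bullet> (((*v) ?Q) ^^ k) (axis a 1) = 0" if "k < ?r m - 1" for k
      using r(2)[of k \<rho>] le that by simp
    from output_bounded_by_lower_degree_output[OF r(2,3) this horizon]
    obtain C where C: "C \<ge> 0"
      "\<And>u x. is_trajectory ?Q (axis a 1) u x \<Longrightarrow> x 0 = 0 \<Longrightarrow>
      L2_norm_sq T (\<lambda>t. axis \<rho> 1 \<bullet> x t) \<le> ennreal C * L2_norm_sq T (\<lambda>t. axis m 1 \<bullet> x t)"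
      by metis
    have "Sup (?J m) \<le> ennreal C * ennreal (\<delta> m)"
    proof (rule Sup_least)
      fix J assume "J \<in> ?J m"
      then obtain u x where x: "is_trajectory ?Q (axis a 1) u x" "x 0 = 0"
        and le: "L2_norm_sq T (\<lambda>t. axis m 1 \<bullet> x t) \<le> ennreal (\<delta> m)"
        and J: "J = L2_norm_sq T (\<lambda>t. axis \<rho> 1 \<bullet> x t)"
        by blast
      show "J \<le> ennreal C * ennreal (\<delta> m)"
        unfolding J using C(2)[OF x] mult_left_mono[OF le] by (rule order_trans) simp
    qed
    also have "\<dots> < \<infinity>" by (simp add: ennreal_mult_less_top)
    finally show "Sup (?J m) < \<infinity>" .
  next
    assume fin: "Sup (?J m) < \<infinity>"
    show "?r m \<le> ?r \<rho>"
    proof (rule ccontr)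
      assume "\<not> ?r m \<le> ?r \<rho>"
      \<comment> \<open>\<open>?r \<rho> \<ge> 1\<close> keeps the truncated subtraction honest:
        \<open>?r \<rho> - 1 < ?r m - 1\<close>, so the Markov parameter at index
        \<open>?r \<rho> - 1\<close> vanishes for \<open>m\<close> as well.\<close>
      then have zero: "axis m 1 \<bullet> (((*v) ?Q) ^^ k) (axis a 1) = 0" if "k \<le> ?r \<rho> - 1" for k
        using r(2)[of k m] r(1)[of \<rho>] that by simp
      obtain R where R: "R \<ge> 0" "Sup (?J m) = ennreal R"
        using fin by (cases "Sup (?J m)") auto
      then have pos: "R + 1 > 0" by simp
      obtain u x where "u \<in> L2e" "is_trajectory ?Q (axis a 1) u x" "x 0 = 0"
        "L2_norm_sq T (\<lambda>t. axis m 1 \<bullet> x t) \<le> ennreal (\<delta> m)"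
        and ge: "L2_norm_sq T (\<lambda>t. axis \<rho> 1 \<bullet> x t) \<ge> ennreal (R + 1)"
        
        using output_unbounded_by_higher_degree_output
          [OF zero r(2)[of _ \<rho>] r(3)[of \<rho>] horizon thresholds[of m] pos] by blast
      then have "L2_norm_sq T (\<lambda>t. axis \<rho> 1 \<bullet> x t) \<le> Sup (?J m)"
        by (intro Sup_upper CollectI exI[of _ u] exI[of _ x] conjI refl)
      with ge R have "ennreal (R + 1) \<le> ennreal R" by (metis order_trans)
      then show False using R(1) by simp
    qed
  qed
  have "worst_case_impact T (looped_laplacian A \<theta>) \<delta> \<rho> a M < \<infinity>
      \<longleftrightarrow> (\<exists>m\<in>M. Sup (?J m) < \<infinity>)"
    unfolding worst_case_impact_def using \<open>M \<noteq> {}\<close>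
    by (subst Min_less_iff) (simp_all only: finite finite_imageI image_is_empty bex_simps(7) simp_thms not_False_eq_True)
  then show ?thesis by (simp only: fin_iff)
qed

end
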